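(* Let $N=1$, $k>0$ and $l>-1$. (i) If $k\geq l+1$, then $C_{k,l,1}=C_{k,l,1}^{rad}$. Moreover, if $k>l+1$ and $\mathcal{R}_{k,l,1}(M)=C_{k,l,1}^{rad}$ for some measurable set $M\subset\mathbb{R}$ with $0<\mu_l(M)<+\infty$, then $M=(-R,R)$ (up to a Lebesgue null set) for some $R>0$. (ii) If $k<l+1$, then $$\mathcal{R}_{k,l,1}(M)\geq\mathcal{R}_{k,l,1}((0,1))=(l+1)^{k/(l+1)}$$ for all measurable sets $M\subset\mathbb{R}$ with $0<\mu_l(M)<+\infty$.
   Context: On $\mathbb{R}$ put $d\mu_l(x)=|x|^l\,dx$. The $\mu_k$-perimeter of a measurable set $M\subset\mathbb{R}$ is $$P_{\mu_k}(M):=\sup\left\{\int_M (|x|^k v)'\,dx:\ v\in C_0^1(\mathbb{R}),\ |v|\leq 1 \text{ in } M\right\}.$$ For measurable $M$ with $0<\mu_l(M)<+\infty$ set $$\mathcal{R}_{k,l,1}(M):=\frac{P_{\mu_k}(M)}{(\mu_l(M))^{k/(l+1)}},$$ and $C_{k,l,1}:=\inf\{\mathcal{R}_{k,l,1}(M): M \text{ measurable},\ 0<\mu_l(M)<+\infty\}$. Further $$C_{k,l,1}^{rad}:=2^{(l-k+1)/(l+1)}(l+1)^{k/(l+1)}=\mathcal{R}_{k,l,1}((-1,1)).$$ *)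

theory Defs
  imports "HOL-Analysis.Analysis"
begin

text \<open>\<^prop>\<open>(0::real) powr l = 0\<close> also for negative \<open>l\<close>; this affects the density only on the null set
  \<open>{0}\<close>. The base measure is the complete measure \<^term>\<open>lebesgue\<close>, so the sets considered below
  are the Lebesgue measurable ones.\<close>

definition weighted_measure :: "real \<Rightarrow> real measure" where
  "weighted_measure l = density lebesgue (\<lambda>x. ennreal (\<bar>x\<bar> powr l))"

text \<open>\<open>C\<^sub>0\<^sup>1(\<real>)\<close>: the subscript denotes compact support.\<close>

definition C1_compact_support :: "(real \<Rightarrow> real) set" where
  "C1_compact_support =
     {v. v C1_differentiable_on UNIV \<and> compact (closure {x. v x \<noteq> 0})}"

text \<open>For \<open>0 < k\<close> the function \<open>\<bar>x\<bar> powr k * v x\<close> is differentiable at every \<open>x \<noteq> 0\<close>; the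
  (arbitrary) value of \<^const>\<open>deriv\<close> at a possible point of non-differentiability \<open>0\<close> does not
  affect the integral. The supremum is taken in \<^typ>\<open>ereal\<close> and may be infinite.\<close>

definition weighted_perimeter :: "real \<Rightarrow> real set \<Rightarrow> ereal" where
  "weighted_perimeter k M =
     (SUP v \<in> {v \<in> C1_compact_support. \<forall>x\<in>M. \<bar>v x\<bar> \<le> 1}.
        ereal (LINT x:M|lebesgue. deriv (\<lambda>y. \<bar>y\<bar> powr k * v y) x))"

definition admissible_sets :: "real \<Rightarrow> real set set" where
  "admissible_sets l =
     {M \<in> sets lebesgue. 0 < emeasure (weighted_measure l) M \<and>
                         emeasure (weighted_measure l) M < \<infinity>}"

definition isoperimetric_ratio :: "real \<Rightarrow> real \<Rightarrow> real set \<Rightarrow> ereal" where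
  "isoperimetric_ratio k l M =
     weighted_perimeter k M / ereal (measure (weighted_measure l) M powr (k / (l + 1)))"

definition isoperimetric_const :: "real \<Rightarrow> real \<Rightarrow> ereal" where
  "isoperimetric_const k l = (INF M \<in> admissible_sets l. isoperimetric_ratio k l M)"

definition isoperimetric_const_rad :: "real \<Rightarrow> real \<Rightarrow> real" where
  "isoperimetric_const_rad k l =
     2 powr ((l - k + 1) / (l + 1)) * (l + 1) powr (k / (l + 1))"

end

theory Submission
  imports Defs
begin

text \<open>A primitive \<open>w\<close> supported away from 0 with \<open>\<bar>w x\<bar> \<le> \<bar>x\<bar> powr k\<close> is of the form \<open>\<bar>x\<bar> powr k * v x\<close>
  for an admissible test function \<open>v\<close>. If \<open>M\<close> has positive measure beyond \<open>r > 0\<close>, such a \<open>w\<close> can rise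
  to \<open>r powr k\<close> on \<open>M\<close> and fall back to 0 on the complement, which is not null near infinity because
  \<open>M\<close> has finite mass and \<open>l > -1\<close>. Doing this on both half-lines bounds the perimeter below by
  \<open>r powr k + s powr k\<close>, hence by \<open>x powr p + y powr p\<close> with \<open>p = k / (l + 1)\<close>, where \<open>x\<close> and \<open>y\<close> are
  \<open>l + 1\<close> times the masses of the two halves of \<open>M\<close>. Convexity (\<open>p \<ge> 1\<close>) or subadditivity (\<open>p \<le> 1\<close>) of the
  power concludes. In the equality case with \<open>p > 1\<close>, strict convexity makes the halves equal in mass,
  and the bound forbids \<open>M\<close> to have positive measure outside the interval of that mass.\<close>

section \<open>Power inequalities\<close>

text \<open>Two elementary bounds combine: \<open>ln (inverse u) <= inverse u - 1\<close>, and
  \<open>1 + z <= exp z\<close> for \<open>z = (p - 1) * ln u\<close>. This is Bernoulli's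
  inequality for real exponents; its strict form serves the equality case.\<close>

lemma powr_ge_tangent:
  fixes u p :: real
  assumes "0 \<le> u" "1 \<le> p"
  shows "1 + p * (u - 1) \<le> u powr p"
    and "1 < p \<Longrightarrow> u \<noteq> 1 \<Longrightarrow> 1 + p * (u - 1) < u powr p"
proof -
  \<comment> \<open>\<open>u + (p - 1) * (u * ln u)\<close> separates the tangent from the power;
    strictness enters on the tangent side only.\<close>
  have pos: "1 + p * (u - 1) \<le> u + (p - 1) * (u * ln u)"
      "1 < p \<Longrightarrow> u \<noteq> 1 \<Longrightarrow> 1 + p * (u - 1) < u + (p - 1) * (u * ln u)"
      "u + (p - 1) * (u * ln u) \<le> u powr p" if "0 < u"
  proof -
    have "ln (inverse u) \<le> inverse u - 1" using that by (intro ln_le_minus_one) simp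
    then have "u * (- ln u) \<le> u * (inverse u - 1)"
      using that by (intro mult_left_mono) (auto simp: ln_inverse)
    then have le: "u - 1 \<le> u * ln u" using that by (simp add: algebra_simps)
    have "u * ln u \<noteq> u - 1" if "u \<noteq> 1"
    proof
      assume "u * ln u = u - 1"
      then have "u * ln (inverse u) = u * (inverse u - 1)"
        using \<open>0 < u\<close> by (simp add: ln_inverse algebra_simps)
      then have "ln (inverse u) = inverse u - 1" using \<open>0 < u\<close> by simp
      then have "inverse u = 1" using \<open>0 < u\<close> by (intro ln_eq_minus_one) auto
      then show False using that by simp
    qed
    then have less: "u - 1 < u * ln u" if "u \<noteq> 1" using le that by fastforce
    have eq: "1 + p * (u - 1) = u + (p - 1) * (u - 1)" by (simp add: algebra_simps)
    show "1 + p * (u - 1) \<le> u + (p - 1) * (u * ln u)"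
      unfolding eq using le assms(2) by (simp add: mult_left_mono)
    show "1 + p * (u - 1) < u + (p - 1) * (u * ln u)" if "1 < p" "u \<noteq> 1"
      unfolding eq using less[OF that(2)] that(1) by simp
    have "u + (p - 1) * (u * ln u) = u * (1 + (p - 1) * ln u)" by (simp add: algebra_simps)
    also have "\<dots> \<le> u * exp ((p - 1) * ln u)" using that by (intro mult_left_mono) auto
    also have "\<dots> = exp (ln u + (p - 1) * ln u)" using that by (simp add: exp_add)
    also have "\<dots> = u powr p" using that by (simp add: powr_def algebra_simps)
    finally show "u + (p - 1) * (u * ln u) \<le> u powr p" .
  qed
  \<comment> \<open>At \<open>u = 0\<close> the power is 0 and the tangent takes the value
    \<open>1 - p\<close>.\<close>
  show "1 + p * (u - 1) \<le> u powr p"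
    using pos(1,3) assms by (cases "u = 0") auto
  show "1 + p * (u - 1) < u powr p" if "1 < p" "u \<noteq> 1"
    using pos(2,3) assms that by (cases "u = 0") auto
qed

text \<open>In units of the midpoint \<open>c\<close> the two arguments add up to 2, so the linear
  terms of their tangents at 1 cancel. Unequal arguments differ from \<open>c\<close>, which makes a
  tangent bound strict.\<close>

lemma powr_midpoint_convex:
  fixes x y p :: real
  assumes "0 \<le> x" "0 \<le> y" "0 < x + y" "1 \<le> p"
  shows "2 powr (1 - p) * (x + y) powr p \<le> x powr p + y powr p"
    and "1 < p \<Longrightarrow> x \<noteq> y \<Longrightarrow> 2 powr (1 - p) * (x + y) powr p < x powr p + y powr p"
proof -
  define c where "c = (x + y) / 2"
  have "0 < c" using assms by (simp add: c_def)
  have L: "2 powr (1 - p) * (x + y) powr p = c powr p * 2"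
    using assms by (simp add: c_def powr_divide powr_diff)
  have R: "x powr p + y powr p = c powr p * ((x / c) powr p + (y / c) powr p)"
    using assms \<open>0 < c\<close> by (simp add: powr_divide distrib_left)
  have "x + y = 2 * c" by (simp add: c_def)
  then have sum: "x / c + y / c = 2" using \<open>0 < c\<close> by (simp flip: add_divide_distrib)
  have tangents: "(1 + p * (x / c - 1)) + (1 + p * (y / c - 1)) = 2"
  proof -
    have "(1 + p * (x / c - 1)) + (1 + p * (y / c - 1)) = 2 + p * (x / c + y / c - 2)"
      by (simp add: algebra_simps)
    then show ?thesis by (simp add: sum)
  qed
  have nonneg: "0 \<le> x / c" "0 \<le> y / c" using assms \<open>0 < c\<close> by auto
  note x = powr_ge_tangent[OF nonneg(1) assms(4)] and y = powr_ge_tangent[OF nonneg(2) assms(4)]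
  show "2 powr (1 - p) * (x + y) powr p \<le> x powr p + y powr p"
    unfolding L R using x(1) y(1) tangents by (intro mult_left_mono) auto
  show "2 powr (1 - p) * (x + y) powr p < x powr p + y powr p" if "1 < p" "x \<noteq> y"
  proof -
    have "x / c \<noteq> 1" using that(2) \<open>0 < c\<close> by (auto simp: c_def field_simps)
    then show ?thesis
      unfolding L R using x(2)[OF that(1)] y(1) tangents \<open>0 < c\<close> by (intro mult_strict_left_mono) auto
  qed
qed

text \<open>The fractions \<open>x / (x + y)\<close> and \<open>y / (x + y)\<close> add up to 1 and
  lie between 0 and 1, where an exponent \<open>p <= 1\<close> does not decrease a number.\<close>

lemma powr_subadditive:
  fixes x y p :: real
  assumes "0 \<le> x" "0 \<le> y" "0 < x + y" "p \<le> 1"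
  shows "(x + y) powr p \<le> x powr p + y powr p"
proof -
  have le: "z / (x + y) \<le> (z / (x + y)) powr p" if "0 \<le> z" "z \<le> x + y" for z
    using powr_mono'[of p 1 "z / (x + y)"] that assms by simp
  have "(x + y) powr p = (x + y) powr p * (x / (x + y) + y / (x + y))"
    using assms by (simp flip: add_divide_distrib)
  also have "\<dots> \<le> (x + y) powr p * ((x / (x + y)) powr p + (y / (x + y)) powr p)"
    using assms by (intro mult_left_mono add_mono le) auto
  also have "\<dots> = x powr p + y powr p"
    using assms by (simp add: powr_divide distrib_left)
  finally show ?thesis .
qed

section \<open>Test functions with prescribed flux\<close>

text \<open>The square is smooth, and positive off 0, so in this form the derivative rules apply to
  the weight on both half-lines at once.\<close>

lemma abs_powr_eq_square_powr: "\<bar>x\<bar> powr r = (x\<^sup>2) powr (r/2)" for x r :: real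
proof -
  have "x\<^sup>2 = \<bar>x\<bar> powr 2" by (simp add: powr_numeral)
  then show ?thesis by (simp only: powr_powr) simp
qed

text \<open>Dividing \<open>w\<close> by the weight gives the test function \<open>v\<close>. As
  \<open>w\<close> vanishes for \<open>\<bar>x\<bar> < s\<close>, the singularity of the quotient at
  0 does no harm, and multiplying back by the weight recovers \<open>w\<close>, so that the
  integrand of the perimeter is \<open>g\<close>.\<close>

lemma weighted_perimeter_ge_primitive:
  fixes w g :: "real \<Rightarrow> real"
  assumes deriv: "\<And>x. (w has_real_derivative g x) (at x)"
    and cont: "continuous_on UNIV g"
    and "0 < s"
    and supp: "\<And>x. \<bar>x\<bar> < s \<or> t < \<bar>x\<bar> \<Longrightarrow> w x = 0 \<and> g x = 0"
    and bound: "\<And>x. \<bar>w x\<bar> \<le> \<bar>x\<bar> powr k"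
  shows "ereal (LINT x:M|lebesgue. g x) \<le> weighted_perimeter k M"
proof -
  define v where "v x = w x * (x\<^sup>2) powr (-(k/2))" for x
  define D where "D x = g x * (x\<^sup>2) powr (-(k/2)) + w x * (-(k/2) * (x\<^sup>2) powr (-(k/2) - 1) * (2 * x))" for x
  have w_cont: "continuous_on UNIV w"
    by (intro continuous_at_imp_continuous_on ballI DERIV_isCont[OF deriv])
  have v_deriv: "(v has_real_derivative D x) (at x)" for x
  proof (cases "\<bar>x\<bar> < s")
    case True
    have "eventually (\<lambda>y. y \<in> ball 0 s) (nhds x)"
      using True by (intro eventually_nhds_in_open) auto
    then have "eventually (\<lambda>y. v y = 0) (nhds x)"
      by (rule eventually_mono) (use supp in \<open>simp add: v_def\<close>)
    then have "(v has_real_derivative 0) (at x) \<longleftrightarrow> ((\<lambda>_. 0) has_real_derivative 0) (at x)"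
      by (intro DERIV_cong_ev refl)
    then show ?thesis using supp True by (simp add: D_def)
  next
    case False
    then have "x\<^sup>2 > 0" using \<open>0 < s\<close> by auto
    then show ?thesis unfolding v_def D_def
      by (auto intro!: derivative_eq_intros deriv)
  qed
  \<comment> \<open>Continuity is glued from two overlapping open sets: \<open>D\<close> is 0 near
    the origin and a continuous expression where \<open>s/2 < \<bar>x\<bar>\<close>.\<close>
  have "continuous_on ({x. \<bar>x\<bar> < s} \<union> {x. s/2 < \<bar>x\<bar>}) D"
  proof (rule continuous_on_open_Un)
    show "open {x. \<bar>x\<bar> < s}" "open {x. s/2 < \<bar>x\<bar>}"
      by (intro open_Collect_less continuous_intros)+
    show "continuous_on {x. \<bar>x\<bar> < s} D"
      by (rule continuous_on_eq[of _ "\<lambda>_. 0"]) (use supp in \<open>auto simp: D_def\<close>)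
    show "continuous_on {x. s/2 < \<bar>x\<bar>} D" unfolding D_def
      by (intro continuous_intros continuous_on_subset[OF cont] continuous_on_subset[OF w_cont])
        (use \<open>0 < s\<close> in auto)
  qed
  also have "{x. \<bar>x\<bar> < s} \<union> {x. s/2 < \<bar>x\<bar>} = UNIV" using \<open>0 < s\<close> by auto
  finally have "v C1_differentiable_on UNIV"
    using v_deriv unfolding C1_differentiable_on_def has_real_derivative_iff_has_vector_derivative by blast
  moreover have "compact (closure {x. v x \<noteq> 0})"
  proof -
    have "{x. v x \<noteq> 0} \<subseteq> cball 0 t"
    proof
      fix x assume "x \<in> {x. v x \<noteq> 0}"
      then have "w x \<noteq> 0" by (auto simp: v_def)
      then show "x \<in> cball 0 t" using supp[of x] by (cases "t < \<bar>x\<bar>") auto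
    qed
    then show ?thesis
      using bounded_subset[OF bounded_cball] compact_closure by blast
  qed
  moreover have "\<bar>v x\<bar> \<le> 1" for x
  proof (cases "x = 0")
    case False
    have "\<bar>v x\<bar> = \<bar>w x\<bar> / \<bar>x\<bar> powr k"
      unfolding v_def abs_powr_eq_square_powr abs_mult powr_minus using False by (simp add: field_simps)
    then show ?thesis using bound[of x] False by simp
  qed (simp add: v_def)
  ultimately have v: "v \<in> {v \<in> C1_compact_support. \<forall>x\<in>M. \<bar>v x\<bar> \<le> 1}"
    by (simp add: C1_compact_support_def)
  have "(\<lambda>y. \<bar>y\<bar> powr k * v y) = w"
  proof
    fix y show "\<bar>y\<bar> powr k * v y = w y"
      using supp[of y] \<open>0 < s\<close> unfolding v_def abs_powr_eq_square_powr powr_minus by (cases "y = 0") auto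
  qed
  then have "deriv (\<lambda>y. \<bar>y\<bar> powr k * v y) = g"
    using deriv by (auto simp: DERIV_imp_deriv)
  then show ?thesis
    unfolding weighted_perimeter_def using v by (auto intro!: SUP_upper2)
qed

lemma integrable_continuous_support:
  fixes g :: "real \<Rightarrow> real"
  assumes "continuous_on UNIV g" and "\<And>x. x \<notin> {s..t} \<Longrightarrow> g x = 0"
  shows "integrable lebesgue g"
proof -
  have "set_integrable lebesgue {s..t} g"
    using assms(1) by (intro absolutely_integrable_continuous_real) (auto intro: continuous_on_subset)
  moreover have "(\<lambda>x. indicator {s..t} x *\<^sub>R g x) = g"
    using assms(2) by (auto simp: indicator_def fun_eq_iff)
  ultimately show ?thesis by (simp add: set_integrable_def)
qed

text \<open>Regularity of Lebesgue measure gives a closed \<open>K\<close> inside \<open>A\<close>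
  and an open \<open>U\<close> around \<open>K\<close>; a Urysohn function between them is a
  continuous bump \<open>f0\<close>. Its integral \<open>I\<close> is at least the measure of
  \<open>K\<close>, while outside \<open>A\<close> it is nonzero only on \<open>U - K\<close>.
  Divided by \<open>I\<close>, its primitive climbs from 0 to 1 almost entirely on
  \<open>A\<close>.\<close>

lemma smooth_step:
  fixes A :: "real set"
  assumes A: "A \<in> sets lebesgue" "A \<subseteq> {p<..<q}" "A \<notin> null_sets lebesgue" and "0 < e"
  obtains F f :: "real \<Rightarrow> real" where
    "\<And>x. (F has_real_derivative f x) (at x)" "continuous_on UNIV f"
    "\<And>x. 0 \<le> f x" "\<And>x. x \<notin> {p<..<q} \<Longrightarrow> f x = 0"
    "\<And>x. x \<le> p \<Longrightarrow> F x = 0" "\<And>x. q \<le> x \<Longrightarrow> F x = 1" "\<And>x. 0 \<le> F x" "\<And>x. F x \<le> 1"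
    "(LINT x|lebesgue. f x) = 1"
    "\<And>B. B \<in> sets lebesgue \<Longrightarrow> B \<inter> A = {} \<Longrightarrow> (LINT x:B|lebesgue. f x) \<le> e"
proof -
  have "A \<noteq> {}" using A by auto
  then have "p < q" using A(2) by fastforce
  have "bounded A" using A(2) bounded_subset[OF bounded_box[of p q]] by simp
  then have A_meas: "A \<in> lmeasurable" using A(1) bounded_set_imp_lmeasurable by blast
  then have "0 < measure lebesgue A"
    using A(1,3) by (simp add: null_sets_def emeasure_eq_measure2 zero_less_measure_iff)
  \<comment> \<open>The tolerance is the measure of \<open>A\<close> itself: less than all of
    \<open>A\<close> is lost, so \<open>K\<close> keeps positive measure.\<close>
  obtain K where K: "closed K" "K \<subseteq> A" "A - K \<in> lmeasurable"
      and AK: "emeasure lebesgue (A - K) < ennreal (measure lebesgue A)"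
    by (rule sets_lebesgue_inner_closed[OF A(1) \<open>0 < measure lebesgue A\<close>])
  have K_meas: "K \<in> lmeasurable"
    using K(1,2) \<open>bounded A\<close> bounded_subset lmeasurable_compact compact_eq_bounded_closed by blast
  have "measure lebesgue (A - K) < measure lebesgue A"
    using AK K(3) by (simp add: emeasure_eq_measure2 ennreal_less_iff)
  moreover have "measure lebesgue (A - K) = measure lebesgue A - measure lebesgue K"
    using K A_meas K_meas by (intro measure_Diff) (auto simp: fmeasurable_def)
  ultimately have mK: "0 < measure lebesgue K" by simp
  then have "0 < e * measure lebesgue K" using \<open>0 < e\<close> by simp
  \<comment> \<open>The factor \<open>measure lebesgue K\<close> is absorbed by the later division
    by \<open>I\<close>, which dominates it.\<close>
  then obtain U where U: "open U" "K \<subseteq> U" "U - K \<in> lmeasurable"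
      and UK: "emeasure lebesgue (U - K) < ennreal (e * measure lebesgue K)"
    by (rule sets_lebesgue_outer_open[OF fmeasurableD[OF K_meas]])
  define V where "V = U \<inter> {p<..<q}"
  obtain f0 :: "real \<Rightarrow> real" where f0: "continuous_on UNIV f0"
      "\<And>x. f0 x \<in> closed_segment 1 0" "\<And>x. x \<in> K \<Longrightarrow> f0 x = 1" "\<And>x. x \<in> -V \<Longrightarrow> f0 x = 0"
  proof (rule Urysohn[of K "-V" "1::real" 0])
    have "open V" using U(1) by (auto simp: V_def)
    then show "closed (- V)" by (rule closed_Compl)
    show "K \<inter> - V = {}" using K(2) U(2) A(2) by (auto simp: V_def)
  qed (use K in auto)
  have f0_bd: "0 \<le> f0 x" "f0 x \<le> 1" for x
    using f0(2)[of x] by (auto simp: closed_segment_eq_real_ivl split: if_splits)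
  have f0_supp: "f0 x = 0" if "x \<notin> {p<..<q}" for x using f0(4)[of x] that by (auto simp: V_def)
  have f0_int: "integrable lebesgue f0"
    by (rule integrable_continuous_support[OF f0(1), of p q]) (use f0_supp in auto)
  obtain F0 where F0: "\<And>x. (F0 has_real_derivative f0 x) (at x)"
    using einterval_antiderivative[of "-\<infinity>" \<infinity> f0] f0(1)
    by (auto simp: continuous_on_eq_continuous_at has_real_derivative_iff_has_vector_derivative)
  define I where "I = (LINT x|lebesgue. f0 x)"
  have I: "I = F0 q - F0 p"
  proof -
    have "(f0 has_integral (F0 q - F0 p)) {p..q}"
    proof (rule fundamental_theorem_of_calculus)
      fix x
      show "(F0 has_vector_derivative f0 x) (at x within {p..q})"
        using F0[of x] unfolding has_real_derivative_iff_has_vector_derivative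
        by (rule has_vector_derivative_at_within)
    qed (use \<open>p < q\<close> in simp)
    then have "(f0 has_integral (F0 q - F0 p)) UNIV"
      by (rule has_integral_on_superset) (use f0_supp in auto)
    moreover have "(f0 has_integral I) UNIV"
      using has_integral_integral_lebesgue[OF f0_int] by (simp add: I_def)
    ultimately show ?thesis using has_integral_unique by blast
  qed
  have I_ge: "measure lebesgue K \<le> I"
  proof -
    have "(LINT x|lebesgue. indicator K x) \<le> I" unfolding I_def
      using K_meas f0_bd f0(3) by (intro integral_mono f0_int integrable_real_indicator)
        (auto simp: fmeasurable_def indicator_def)
    then show ?thesis by simp
  qed
  have "0 < I" using I_ge mK by simp
  \<comment> \<open>Where the bump vanishes, the primitive is monotone in both directions.\<close>
  have const: "F0 x = F0 y" if "x \<le> y" "\<And>z. z \<in> {x..y} \<Longrightarrow> f0 z = 0" for x y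
  proof (rule DERIV_nonneg_imp_nondecreasing[OF that(1), THEN antisym])
    show "F0 y \<le> F0 x"
      by (rule DERIV_nonpos_imp_nonincreasing[OF that(1)]) (use F0 that(2) in fastforce)
  qed (use F0 f0_bd in blast)
  have F0_mono: "F0 x \<le> F0 y" if "x \<le> y" for x y
    by (rule DERIV_nonneg_imp_nondecreasing[OF that]) (use F0 f0_bd in blast)
  have left: "F0 x = F0 p" if "x \<le> p" for x using const[OF that] f0_supp by auto
  have right: "F0 x = F0 q" if "q \<le> x" for x using const[OF that] f0_supp by auto
  have range: "F0 p \<le> F0 x" "F0 x \<le> F0 q" for x
    using F0_mono left right by (metis linear)+
  show ?thesis
  proof (rule that[of "\<lambda>x. (F0 x - F0 p) / I" "\<lambda>x. f0 x / I"])
    fix B :: "real set" assume B: "B \<in> sets lebesgue" "B \<inter> A = {}"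
    have UK': "measure lebesgue (U - K) \<le> e * measure lebesgue K"
      using UK U(3) \<open>0 < e * measure lebesgue K\<close>
      by (simp add: emeasure_eq_measure2 ennreal_less_iff)
    have "(LINT x:B|lebesgue. f0 x) \<le> (LINT x|lebesgue. indicator (U - K) x)"
      unfolding set_lebesgue_integral_def
    proof (rule integral_mono)
      show "integrable lebesgue (\<lambda>x. indicator B x *\<^sub>R f0 x)"
        using integrable_mult_indicator[OF B(1) f0_int] .
      show "integrable lebesgue (indicator (U - K) :: real \<Rightarrow> real)"
        using U(3) by (auto simp: fmeasurable_def intro!: integrable_real_indicator)
      show "indicator B x *\<^sub>R f0 x \<le> indicator (U - K) x" for x
        using f0_bd[of x] f0(4)[of x] B(2) K(2) by (auto simp: indicator_def V_def)
    qed
    also have "\<dots> = measure lebesgue (U - K)" by simp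
    also have "\<dots> \<le> e * measure lebesgue K" by (rule UK')
    also have "\<dots> \<le> e * I" using I_ge \<open>0 < e\<close> by simp
    finally show "(LINT x:B|lebesgue. f0 x / I) \<le> e"
      using \<open>0 < I\<close> by (simp add: divide_le_eq)
  next
    show "((\<lambda>x. (F0 x - F0 p) / I) has_real_derivative f0 x / I) (at x)" for x
      using \<open>0 < I\<close> by (auto intro!: derivative_eq_intros F0)
    show "continuous_on UNIV (\<lambda>x. f0 x / I)"
      using \<open>0 < I\<close> by (intro continuous_intros f0) auto
    show "(F0 x - F0 p) / I = 1" if "q \<le> x" for x
      using right[OF that] I \<open>0 < I\<close> by simp
    show "(F0 x - F0 p) / I \<le> 1" for x
      using range[of x] I \<open>0 < I\<close> by simp
    show "(LINT x|lebesgue. f0 x / I) = 1"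
      using \<open>0 < I\<close> I_def by (metis div_self integral_divide_zero less_irrefl)
    show "0 \<le> f0 x / I" "0 \<le> (F0 x - F0 p) / I" for x
      using \<open>0 < I\<close> f0_bd(1)[of x] range(1)[of x] by auto
    show "f0 x / I = 0" if "x \<notin> {p<..<q}" for x using f0_supp[OF that] by simp
    show "(F0 x - F0 p) / I = 0" if "x \<le> p" for x using left[OF that] by simp
  qed
qed

text \<open>A countable union of null pieces would be null. Boundedness is what compactly supported
  test functions require.\<close>

lemma bounded_part_not_null:
  fixes M :: "real set"
  assumes M: "M \<in> sets lebesgue" and "M \<inter> {a<..} \<notin> null_sets lebesgue"
  obtains b where "M \<inter> {a<..<b} \<notin> null_sets lebesgue" "a < b"
proof -
  have "M \<inter> {a<..} = (\<Union>n::nat. M \<inter> {a<..<real n})"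
    using reals_Archimedean2 by fastforce
  then have "\<exists>n::nat. M \<inter> {a<..<real n} \<notin> null_sets lebesgue"
    using assms(2) null_sets_UN[where N = "\<lambda>n::nat. M \<inter> {a<..<real n}" and M = lebesgue] by auto
  then obtain n :: nat where n: "M \<inter> {a<..<real n} \<notin> null_sets lebesgue" by blast
  moreover have "a < real n" by (rule ccontr) (use n in simp)
  ultimately show ?thesis using that by blast
qed

text \<open>The primitive rises to \<open>a powr k\<close> essentially inside \<open>M\<close>, stays constant, and falls back to 0
  essentially outside \<open>M\<close>; only the rise contributes to the integral over \<open>M\<close>.\<close>

lemma right_competitor:
  fixes M :: "real set"
  assumes M: "M \<in> sets lebesgue" and "0 \<le> a" "0 < k" "0 < e"
    and beyond: "0 < a \<Longrightarrow> M \<inter> {a<..} \<notin> null_sets lebesgue"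
    and compl: "\<And>c. {c<..} - M \<notin> null_sets lebesgue"
  obtains w g :: "real \<Rightarrow> real" and s t where
    "\<And>x. (w has_real_derivative g x) (at x)" "continuous_on UNIV g" "0 < s"
    "\<And>x. x < s \<or> t < x \<Longrightarrow> w x = 0 \<and> g x = 0" "\<And>x. \<bar>w x\<bar> \<le> \<bar>x\<bar> powr k"
    "a powr k - e \<le> (LINT x:M|lebesgue. g x)"
proof (cases "a = 0")
  case True
  \<comment> \<open>Since \<open>0 powr k = 0\<close>, the target \<open>a powr k - e\<close> is
    negative here and the zero function meets it.\<close>
  show ?thesis
    by (rule that[of "\<lambda>_. 0" "\<lambda>_. 0" 1]) (use True \<open>0 < e\<close> in auto)
next
  case False
  then have "0 < a" using \<open>0 \<le> a\<close> by simp
  \<comment> \<open>Each of the two unit steps may lose \<open>d\<close>; after scaling by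
    \<open>a powr k\<close> the total loss is \<open>e\<close>.\<close>
  define d where "d = e / (2 * a powr k)"
  have "0 < d" using \<open>0 < a\<close> \<open>0 < e\<close> by (simp add: d_def)
  obtain b where b: "M \<inter> {a<..<b} \<notin> null_sets lebesgue" "a < b"
    using bounded_part_not_null[OF M beyond[OF \<open>0 < a\<close>]] .
  have N: "- M \<in> sets lebesgue" using M by (simp add: Compl_in_sets_lebesgue)
  \<comment> \<open>The fall starts only at \<open>b\<close>, after the rise is complete, in a
    bounded part of the complement of \<open>M\<close> that is not null.\<close>
  have "- M \<inter> {b<..} \<notin> null_sets lebesgue" using compl[of b] by (simp add: Diff_eq Int_commute)
  then obtain c where c: "- M \<inter> {b<..<c} \<notin> null_sets lebesgue" "b < c"
    by (rule bounded_part_not_null[OF N])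
  obtain F f :: "real \<Rightarrow> real" where F:
    "\<And>x. (F has_real_derivative f x) (at x)" "continuous_on UNIV f"
    "\<And>x. 0 \<le> f x" "\<And>x. x \<notin> {a<..<b} \<Longrightarrow> f x = 0"
    "\<And>x. x \<le> a \<Longrightarrow> F x = 0" "\<And>x. b \<le> x \<Longrightarrow> F x = 1" "\<And>x. 0 \<le> F x" "\<And>x. F x \<le> 1"
    "(LINT x|lebesgue. f x) = 1"
    "\<And>B. B \<in> sets lebesgue \<Longrightarrow> B \<inter> (M \<inter> {a<..<b}) = {} \<Longrightarrow> (LINT x:B|lebesgue. f x) \<le> d"
    by (rule smooth_step[OF sets.Int[OF M] Int_lower2 b(1) \<open>0 < d\<close>]; (rule that; assumption)?) simp
  obtain H h :: "real \<Rightarrow> real" where H: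
    "\<And>x. (H has_real_derivative h x) (at x)" "continuous_on UNIV h"
    "\<And>x. 0 \<le> h x" "\<And>x. x \<notin> {b<..<c} \<Longrightarrow> h x = 0"
    "\<And>x. x \<le> b \<Longrightarrow> H x = 0" "\<And>x. c \<le> x \<Longrightarrow> H x = 1" "\<And>x. 0 \<le> H x" "\<And>x. H x \<le> 1"
    "(LINT x|lebesgue. h x) = 1"
    "\<And>B. B \<in> sets lebesgue \<Longrightarrow> B \<inter> (- M \<inter> {b<..<c}) = {} \<Longrightarrow> (LINT x:B|lebesgue. h x) \<le> d"
    by (rule smooth_step[OF sets.Int[OF N] Int_lower2 c(1) \<open>0 < d\<close>]; (rule that; assumption)?) simp
  have f_int: "integrable lebesgue f"
    by (rule integrable_continuous_support[OF F(2), of a b]) (use F(4) in auto)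
  have h_int: "integrable lebesgue h"
    by (rule integrable_continuous_support[OF H(2), of b c]) (use H(4) in auto)
  have set_int: "set_integrable lebesgue B f" "set_integrable lebesgue B h" if "B \<in> sets lebesgue" for B
    unfolding set_integrable_def using that f_int h_int by (intro integrable_mult_indicator; simp)+
  let ?N = "- M"
  have f_M: "1 - d \<le> (LINT x:M|lebesgue. f x)"
  proof -
    have "(LINT x:M \<union> ?N|lebesgue. f x) = (LINT x:M|lebesgue. f x) + (LINT x:?N|lebesgue. f x)"
      by (intro set_integral_Un set_int M N) auto
    moreover have "(LINT x:M \<union> ?N|lebesgue. f x) = 1"
      using F(9) by (simp add: set_lebesgue_integral_def)
    moreover have "(LINT x:?N|lebesgue. f x) \<le> d" by (rule F(10)[OF N]) auto
    ultimately show ?thesis by linarith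
  qed
  have h_M: "(LINT x:M|lebesgue. h x) \<le> d" by (rule H(10)[OF M]) auto
  show ?thesis
  proof (rule that[of "\<lambda>x. a powr k * (F x - H x)" "\<lambda>x. a powr k * (f x - h x)" a c])
    show "((\<lambda>x. a powr k * (F x - H x)) has_real_derivative a powr k * (f x - h x)) (at x)" for x
      by (auto intro!: derivative_eq_intros F(1) H(1))
    show "continuous_on UNIV (\<lambda>x. a powr k * (f x - h x))"
      by (intro continuous_intros F(2) H(2))
    show "0 < a" by fact
    show "a powr k * (F x - H x) = 0 \<and> a powr k * (f x - h x) = 0" if "x < a \<or> c < x" for x
      using that F(4,5,6)[of x] H(4,5,6)[of x] b(2) c(2) by auto
    \<comment> \<open>Left of \<open>a\<close> both steps vanish; from \<open>a\<close> on, the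
      weight is at least its value at \<open>a\<close>.\<close>
    show "\<bar>a powr k * (F x - H x)\<bar> \<le> \<bar>x\<bar> powr k" for x
    proof (cases "a \<le> x")
      case True
      have "\<bar>F x - H x\<bar> \<le> 1" using F(7,8)[of x] H(7,8)[of x] by linarith
      then have "\<bar>a powr k * (F x - H x)\<bar> \<le> a powr k"
        by (simp add: abs_mult mult_left_le)
      also have "\<dots> \<le> \<bar>x\<bar> powr k" using True \<open>0 < a\<close> \<open>0 < k\<close> by (intro powr_mono2) auto
      finally show ?thesis .
    qed (use F(5)[of x] H(5)[of x] b(2) in auto)
    have "a powr k - e = a powr k * (1 - d - d)"
      using \<open>0 < a\<close> by (simp add: d_def field_simps)
    also have "\<dots> \<le> a powr k * ((LINT x:M|lebesgue. f x) - (LINT x:M|lebesgue. h x))"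
      using f_M h_M by (intro mult_left_mono) auto
    also have "\<dots> = (LINT x:M|lebesgue. a powr k * (f x - h x))"
      using set_int[OF M] by (simp add: set_integral_diff)
    finally show "a powr k - e \<le> (LINT x:M|lebesgue. a powr k * (f x - h x))" .
  qed
qed

section \<open>Reflection at the origin\<close>

lemma set_integral_lebesgue_reflect:
  fixes f :: "real \<Rightarrow> real"
  shows "(LINT x:uminus ` M|lebesgue. f x) = (LINT x:M|lebesgue. f (- x))"
proof -
  have "(LINT x:uminus ` M|lebesgue. f x) = (LINT x|lebesgue. indicator (uminus ` M) (-x) *\<^sub>R f (- x))"
    unfolding set_lebesgue_integral_def
    using lebesgue_integral_real_affine[of "-1" "\<lambda>x. indicator (uminus ` M) x *\<^sub>R f x" 0] by simp
  also have "(\<lambda>x. indicator (uminus ` M) (-x) *\<^sub>R f (- x)) = (\<lambda>x. indicator M x *\<^sub>R f (- x))"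
    by (auto simp: indicator_def fun_eq_iff)
  finally show ?thesis by (simp add: set_lebesgue_integral_def)
qed

lemma sets_lebesgue_reflect:
  fixes M :: "real set"
  assumes "M \<in> sets lebesgue" shows "uminus ` M \<in> sets lebesgue"
proof -
  have "(*\<^sub>R) (-1::real) -` M \<inter> space lebesgue \<in> sets lebesgue"
    by (rule measurable_sets[OF lebesgue_measurable_scaling assms])
  also have "(*\<^sub>R) (-1::real) -` M \<inter> space lebesgue = uminus ` M"
    by force
  finally show ?thesis .
qed

section \<open>Lower bound for the perimeter\<close>

text \<open>0 always belongs to the set, so that a null half of \<open>M\<close> contributes 0 to the bound below.\<close>

definition essential_radii :: "real set \<Rightarrow> real set" where
  "essential_radii M = {r. 0 \<le> r \<and> (0 < r \<longrightarrow> M \<inter> {r<..} \<notin> null_sets lebesgue)}"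

text \<open>The bounds for the two half-lines add up because the competitor for \<open>M\<close> and
  the reflected competitor for the mirror image have disjoint supports: at each point at most one of
  them is nonzero, so the pointwise bound survives.\<close>

lemma weighted_perimeter_ge_radii:
  fixes M :: "real set"
  assumes M: "M \<in> sets lebesgue" and "0 < k"
    and r: "r \<in> essential_radii M" and s: "s \<in> essential_radii (uminus ` M)"
    and compl: "\<And>c. {c<..} - M \<notin> null_sets lebesgue" "\<And>c. {c<..} - uminus ` M \<notin> null_sets lebesgue"
  shows "ereal (r powr k + s powr k) \<le> weighted_perimeter k M"
proof (rule ereal_le_epsilon2)
  fix e :: real assume "0 < e"
  then have "0 < e / 2" by simp
  from r have r': "0 \<le> r" and r'': "0 < r \<Longrightarrow> M \<inter> {r<..} \<notin> null_sets lebesgue"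
    by (auto simp: essential_radii_def)
  from s have s': "0 \<le> s" and s'': "0 < s \<Longrightarrow> uminus ` M \<inter> {s<..} \<notin> null_sets lebesgue"
    by (auto simp: essential_radii_def)
  obtain w1 g1 :: "real \<Rightarrow> real" and s1 t1 where 1:
    "\<And>x. (w1 has_real_derivative g1 x) (at x)" "continuous_on UNIV g1" "0 < s1"
    "\<And>x. x < s1 \<or> t1 < x \<Longrightarrow> w1 x = 0 \<and> g1 x = 0" "\<And>x. \<bar>w1 x\<bar> \<le> \<bar>x\<bar> powr k"
    "r powr k - e / 2 \<le> (LINT x:M|lebesgue. g1 x)"
    by (rule right_competitor[OF M r' \<open>0 < k\<close> \<open>0 < e / 2\<close> r'' compl(1)]; (rule that; assumption)?)
  obtain w2 g2 :: "real \<Rightarrow> real" and s2 t2 where 2: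
    "\<And>x. (w2 has_real_derivative g2 x) (at x)" "continuous_on UNIV g2" "0 < s2"
    "\<And>x. x < s2 \<or> t2 < x \<Longrightarrow> w2 x = 0 \<and> g2 x = 0" "\<And>x. \<bar>w2 x\<bar> \<le> \<bar>x\<bar> powr k"
    "s powr k - e / 2 \<le> (LINT x:uminus ` M|lebesgue. g2 x)"
    by (rule right_competitor[OF sets_lebesgue_reflect[OF M] s' \<open>0 < k\<close> \<open>0 < e / 2\<close> s'' compl(2)]; (rule that; assumption)?)
  have g2_cont: "continuous_on UNIV (\<lambda>x. g2 (- x))"
    by (rule continuous_on_compose2[OF 2(2)]) (auto intro: continuous_intros)
  have int1: "integrable lebesgue g1"
    by (rule integrable_continuous_support[OF 1(2), of s1 t1]) (use 1(4) in force)
  have int2: "integrable lebesgue (\<lambda>x. g2 (- x))"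
    by (rule integrable_continuous_support[OF g2_cont, of "-t2" "-s2"]) (use 2(4) in force)
  have "ereal (LINT x:M|lebesgue. g1 x + g2 (- x)) \<le> weighted_perimeter k M"
  \<comment> \<open>Reflection reverses the sign of the derivative of \<open>w2\<close>; the minus
    sign restores it, so that the integral over the mirror image enters with a plus.\<close>
  proof (rule weighted_perimeter_ge_primitive[of "\<lambda>x. w1 x - w2 (- x)" _ "min s1 s2" "max t1 t2"])
    fix x :: real
    have "((\<lambda>x. w2 (- x)) has_real_derivative g2 (- x) * (- 1)) (at x)"
      by (rule DERIV_chain2[OF 2(1)]) (auto intro!: derivative_eq_intros)
    from DERIV_diff[OF 1(1) this]
    show "((\<lambda>x. w1 x - w2 (- x)) has_real_derivative g1 x + g2 (- x)) (at x)" by simp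
    show "w1 x - w2 (- x) = 0 \<and> g1 x + g2 (- x) = 0" if "\<bar>x\<bar> < min s1 s2 \<or> max t1 t2 < \<bar>x\<bar>"
    proof -
      have "x < s1 \<or> t1 < x" "- x < s2 \<or> t2 < - x" using that 1(3) 2(3) by auto
      then show ?thesis using 1(4) 2(4) by simp
    qed
    show "\<bar>w1 x - w2 (- x)\<bar> \<le> \<bar>x\<bar> powr k"
    proof (cases "0 \<le> x")
      case True
      then show ?thesis using 2(4)[of "-x"] 2(3) 1(5)[of x] by simp
    next
      case False
      then show ?thesis using 1(4)[of x] 1(3) 2(5)[of "-x"] by simp
    qed
  next
    show "continuous_on UNIV (\<lambda>x. g1 x + g2 (- x))"
      by (intro continuous_on_add 1(2) g2_cont)
    show "0 < min s1 s2" using 1(3) 2(3) by simp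
  qed
  moreover have "r powr k + s powr k - e \<le> (LINT x:M|lebesgue. g1 x + g2 (- x))"
  proof -
    have "set_integrable lebesgue M g1" "set_integrable lebesgue M (\<lambda>x. g2 (- x))"
      unfolding set_integrable_def by (intro integrable_mult_indicator M int1 int2)+
    then have "(LINT x:M|lebesgue. g1 x + g2 (- x)) = (LINT x:M|lebesgue. g1 x) + (LINT x:uminus ` M|lebesgue. g2 x)"
      by (simp add: set_integral_lebesgue_reflect)
    then show ?thesis using 1(6) 2(6) by linarith
  qed
  ultimately have "ereal (r powr k + s powr k - e) \<le> weighted_perimeter k M"
    by (meson order_trans ereal_less_eq(3))
  then show "ereal (r powr k + s powr k) \<le> weighted_perimeter k M + ereal e"
    by (cases "weighted_perimeter k M") auto
qed

text \<open>Powers with \<open>0 < k\<close> are continuous on the nonnegative axis, so the bound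
  passes to limits. This matters already for \<open>{0<..<R}\<close> with \<open>0 < R\<close>:
  there \<open>R\<close> is not an essential radius, only a limit of such.\<close>

lemma weighted_perimeter_ge_closure:
  fixes M :: "real set"
  assumes M: "M \<in> sets lebesgue" and "0 < k"
    and r: "r \<in> closure (essential_radii M)" and s: "s \<in> closure (essential_radii (uminus ` M))"
    and compl: "\<And>c. {c<..} - M \<notin> null_sets lebesgue" "\<And>c. {c<..} - uminus ` M \<notin> null_sets lebesgue"
  shows "ereal (r powr k + s powr k) \<le> weighted_perimeter k M"
proof -
  obtain X Y where X: "\<And>n. X n \<in> essential_radii M" "X \<longlonglongrightarrow> r"
    and Y: "\<And>n. Y n \<in> essential_radii (uminus ` M)" "Y \<longlonglongrightarrow> s"
    using r s unfolding closure_sequential by blast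
  have nonneg: "0 \<le> X n" "0 \<le> Y n" for n using X(1)[of n] Y(1)[of n] by (auto simp: essential_radii_def)
  have "(\<lambda>n. ereal (X n powr k + Y n powr k)) \<longlonglongrightarrow> ereal (r powr k + s powr k)"
    unfolding lim_ereal using \<open>0 < k\<close> nonneg
    by (intro tendsto_add tendsto_powr2 X Y tendsto_const) auto
  then show ?thesis
    by (rule LIMSEQ_le_const2)
      (use weighted_perimeter_ge_radii[OF M \<open>0 < k\<close> X(1) Y(1) compl] in auto)
qed

section \<open>The weighted measure and its null sets\<close>

lemma sets_weighted_measure [simp, measurable_cong]: "sets (weighted_measure l) = sets lebesgue"
  by (simp add: weighted_measure_def)

lemma borel_measurable_weight [measurable]: "(\<lambda>x. ennreal (\<bar>x\<bar> powr l)) \<in> borel_measurable lebesgue"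
  by (rule measurable_completion) measurable

lemma emeasure_weighted_measure:
  "A \<in> sets lebesgue \<Longrightarrow>
     emeasure (weighted_measure l) A = (\<integral>\<^sup>+x. ennreal (\<bar>x\<bar> powr l) * indicator A x \<partial>lebesgue)"
  unfolding weighted_measure_def by (rule emeasure_density[OF borel_measurable_weight])

text \<open>The density vanishes only at 0, where \<open>0 powr l = 0\<close>, and a point is null
  for Lebesgue measure.\<close>

lemma null_sets_weighted_measure: "null_sets (weighted_measure l) = null_sets lebesgue"
proof (rule set_eqI)
  fix A :: "real set"
  have "AE x in lebesgue. (x \<in> A \<longrightarrow> ennreal (\<bar>x\<bar> powr l) = 0) \<longleftrightarrow> x \<notin> A"
    by (rule eventually_mono[OF AE_completion[OF AE_lborel_singleton[of 0]]]) auto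
  then have "(AE x in lebesgue. x \<in> A \<longrightarrow> ennreal (\<bar>x\<bar> powr l) = 0) \<longleftrightarrow> (AE x in lebesgue. x \<notin> A)"
    by (rule eventually_subst)
  then show "A \<in> null_sets (weighted_measure l) \<longleftrightarrow> A \<in> null_sets lebesgue"
    unfolding weighted_measure_def null_sets_density_iff[OF borel_measurable_weight]
    using AE_iff_null_sets[of A lebesgue] null_setsD2[of A lebesgue] by blast
qed

lemma emeasure_weighted_measure_reflect:
  assumes "M \<in> sets lebesgue"
  shows "emeasure (weighted_measure l) (uminus ` M) = emeasure (weighted_measure l) M"
proof -
  note [measurable] = assms sets_lebesgue_reflect[OF assms]
  have "emeasure (weighted_measure l) (uminus ` M) =
      (\<integral>\<^sup>+x. ennreal (\<bar>x\<bar> powr l) * indicator (uminus ` M) x \<partial>lebesgue)"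
    by (rule emeasure_weighted_measure[OF sets_lebesgue_reflect[OF assms]])
  also have "\<dots> = (\<integral>\<^sup>+x. ennreal (\<bar>- x\<bar> powr l) * indicator (uminus ` M) (- x) \<partial>lebesgue)"
    using nn_integral_real_affine_lebesgue[of "\<lambda>x. ennreal (\<bar>x\<bar> powr l) * indicator (uminus ` M) x" "-1" 0]
    by simp
  also have "\<dots> = (\<integral>\<^sup>+x. ennreal (\<bar>x\<bar> powr l) * indicator M x \<partial>lebesgue)"
    by (intro nn_integral_cong) (auto simp: indicator_def)
  also have "\<dots> = emeasure (weighted_measure l) M"
    by (rule emeasure_weighted_measure[OF assms, symmetric])
  finally show ?thesis .
qed

lemma emeasure_weighted_measure_interval:
  assumes "-1 < l" "0 \<le> r"
  shows "emeasure (weighted_measure l) {0<..<r} = ennreal (r powr (l + 1) / (l + 1))"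
proof -
  have "emeasure (weighted_measure l) {0<..<r} =
      (\<integral>\<^sup>+x. ennreal (\<bar>x\<bar> powr l) * indicator {0<..<r} x \<partial>lebesgue)"
    by (rule emeasure_weighted_measure) auto
  also have "\<dots> = (\<integral>\<^sup>+x. ennreal (\<bar>x\<bar> powr l) * indicator {0<..<r} x \<partial>lborel)"
    by (rule nn_integral_completion)
  also have "\<dots> = (\<integral>\<^sup>+x. ennreal (x powr l) * indicator {0..r} x \<partial>lborel)"
  proof (rule nn_integral_cong_AE)
    show "AE x in lborel. ennreal (\<bar>x\<bar> powr l) * indicator {0<..<r} x = ennreal (x powr l) * indicator {0..r} x"
      using AE_lborel_singleton[of 0] AE_lborel_singleton[of r]
      by eventually_elim (auto simp: indicator_def)
  qed
  also have "\<dots> = ennreal (r powr (l + 1) / (l + 1))"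
    by (intro nn_integral_has_integral_lebesgue' has_integral_powr_from_0 assms) auto
  finally show ?thesis .
qed

lemma singleton_null_lebesgue: "{x::real} \<in> null_sets lebesgue"
  by (simp add: null_sets_completionI)

text \<open>Were \<open>M\<close> null beyond \<open>r\<close>, its positive part would lie in
  \<open>{0<..<r}\<close> up to a null set, and that interval has too little mass.\<close>

lemma not_null_beyond:
  assumes M: "M \<in> sets lebesgue" and "-1 < l" "0 \<le> r"
    and less: "ennreal (r powr (l + 1) / (l + 1)) < emeasure (weighted_measure l) (M \<inter> {0<..})"
  shows "M \<inter> {r<..} \<notin> null_sets lebesgue"
proof
  assume "M \<inter> {r<..} \<in> null_sets lebesgue"
  then have null: "{r} \<union> M \<inter> {r<..} \<in> null_sets (weighted_measure l)"
    unfolding null_sets_weighted_measure by (intro null_sets.Un singleton_null_lebesgue)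
  have "emeasure (weighted_measure l) (M \<inter> {0<..})
      \<le> emeasure (weighted_measure l) ({0<..<r} \<union> ({r} \<union> M \<inter> {r<..}))"
  proof (rule emeasure_mono)
    show "{0<..<r} \<union> ({r} \<union> M \<inter> {r<..}) \<in> sets (weighted_measure l)"
      by (rule sets.Un[OF _ null_setsD2[OF null]]) simp
  qed auto
  also have "\<dots> = emeasure (weighted_measure l) {0<..<r}"
    by (intro emeasure_Un_null_set null) auto
  also have "\<dots> = ennreal (r powr (l + 1) / (l + 1))"
    using assms by (intro emeasure_weighted_measure_interval) auto
  finally show False using less by simp
qed

lemma powr_radius:
  fixes l m :: real
  assumes "-1 < l" "0 \<le> m"
  shows "(((l + 1) * m) powr (1 / (l + 1))) powr (l + 1) / (l + 1) = m"
  using assms by (simp add: powr_powr)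

text \<open>Half-lines have infinite mass because \<open>-1 < l\<close>, so a set of finite mass
  cannot fill one up to a null set. This leaves room for the test functions to return to 0 off
  \<open>M\<close>.\<close>

lemma compl_not_null:
  assumes M: "M \<in> sets lebesgue" and "-1 < l" and fin: "emeasure (weighted_measure l) M < \<infinity>"
  shows "{c<..} - M \<notin> null_sets lebesgue"
proof
  assume "{c<..} - M \<in> null_sets lebesgue"
  define d where "d = max c 0"
  define C where "C = d powr (l + 1) / (l + 1)"
  define m where "m = measure (weighted_measure l) M"
  \<comment> \<open>\<open>{0<..<r}\<close> has mass \<open>m + C + 1\<close>, one more than
    \<open>M\<close> and \<open>{0<..<d}\<close> together can provide.\<close>
  define r where "r = ((l + 1) * (m + C + 1)) powr (1 / (l + 1))"
  have "0 \<le> C" "0 \<le> m" using \<open>-1 < l\<close> by (auto simp: C_def m_def)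
  have m: "emeasure (weighted_measure l) M = ennreal m"
    using fin by (auto simp: m_def emeasure_eq_ennreal_measure)
  have null: "{d} \<union> ({c<..} - M) \<in> null_sets (weighted_measure l)"
    unfolding null_sets_weighted_measure
    using \<open>{c<..} - M \<in> null_sets lebesgue\<close> by (intro null_sets.Un singleton_null_lebesgue)
  have "ennreal (m + C + 1) = emeasure (weighted_measure l) {0<..<r}"
    using powr_radius[OF \<open>-1 < l\<close>, of "m + C + 1"] \<open>0 \<le> C\<close> \<open>0 \<le> m\<close>
    by (subst emeasure_weighted_measure_interval) (auto simp: r_def \<open>-1 < l\<close>)
  also have "\<dots> \<le> emeasure (weighted_measure l) (({0<..<d} \<union> M) \<union> ({d} \<union> ({c<..} - M)))"
  proof (rule emeasure_mono)
    show "({0<..<d} \<union> M) \<union> ({d} \<union> ({c<..} - M)) \<in> sets (weighted_measure l)"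
      by (rule sets.Un[OF _ null_setsD2[OF null]]) (use M in auto)
  qed (auto simp: d_def)
  also have "\<dots> = emeasure (weighted_measure l) ({0<..<d} \<union> M)"
    using M by (intro emeasure_Un_null_set null) auto
  also have "\<dots> \<le> emeasure (weighted_measure l) {0<..<d} + emeasure (weighted_measure l) M"
    using M by (intro emeasure_subadditive) auto
  also have "\<dots> = ennreal C + ennreal m"
    using \<open>-1 < l\<close> by (simp add: m emeasure_weighted_measure_interval C_def d_def)
  also have "\<dots> = ennreal (C + m)" using \<open>0 \<le> C\<close> \<open>0 \<le> m\<close> by simp
  finally show False using \<open>0 \<le> C\<close> \<open>0 \<le> m\<close> by (simp add: ennreal_le_iff)
qed

section \<open>Masses and radii of the two halves\<close>

definition half_mass :: "real \<Rightarrow> real set \<Rightarrow> real" where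
  "half_mass l M = measure (weighted_measure l) (M \<inter> {0<..})"

text \<open>The radius of the interval starting at 0 that has the mass of the positive part of \<open>M\<close>.\<close>

definition half_radius :: "real \<Rightarrow> real set \<Rightarrow> real" where
  "half_radius l M = ((l + 1) * half_mass l M) powr (1 / (l + 1))"

lemma half_mass_nonneg [simp]: "0 \<le> half_mass l M"
  by (simp add: half_mass_def)

lemma half_radius_nonneg [simp]: "0 \<le> half_radius l M"
  by (simp add: half_radius_def)

lemma half_radius_powr: "half_radius l M powr k = ((l + 1) * half_mass l M) powr (k / (l + 1))"
  by (simp add: half_radius_def powr_powr)

lemma half_radius_mass: "-1 < l \<Longrightarrow> half_radius l M powr (l + 1) / (l + 1) = half_mass l M"
  unfolding half_radius_def by (rule powr_radius) auto

lemma admissible_sets_reflect: "M \<in> admissible_sets l \<Longrightarrow> uminus ` M \<in> admissible_sets l"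
  by (simp add: admissible_sets_def emeasure_weighted_measure_reflect sets_lebesgue_reflect)

lemma emeasure_half_mass:
  assumes "M \<in> admissible_sets l"
  shows "emeasure (weighted_measure l) (M \<inter> {0<..}) = ennreal (half_mass l M)"
proof -
  have "emeasure (weighted_measure l) (M \<inter> {0<..}) \<le> emeasure (weighted_measure l) M"
    using assms by (intro emeasure_mono) (auto simp: admissible_sets_def)
  also have "\<dots> < \<infinity>" using assms by (simp add: admissible_sets_def)
  finally show ?thesis by (simp add: half_mass_def emeasure_eq_ennreal_measure)
qed

text \<open>Cut at 0, a null point, and reflect the negative part: it becomes the positive part of
  the mirror image.\<close>

lemma emeasure_eq_half_masses:
  assumes "M \<in> admissible_sets l"
  shows "emeasure (weighted_measure l) M = ennreal (half_mass l M + half_mass l (uminus ` M))"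
proof -
  let ?W = "weighted_measure l"
  have M: "M \<in> sets lebesgue" using assms by (simp add: admissible_sets_def)
  have "emeasure ?W M = emeasure ?W ((M \<inter> {0<..} \<union> M \<inter> {..<0}) \<union> M \<inter> {0})"
    by (intro arg_cong[where f = "emeasure ?W"]) auto
  also have "\<dots> = emeasure ?W (M \<inter> {0<..} \<union> M \<inter> {..<0})"
  proof (rule emeasure_Un_null_set)
    show "M \<inter> {0} \<in> null_sets ?W"
      using null_set_Int2[OF singleton_null_lebesgue[of 0] M]
      by (simp add: null_sets_weighted_measure Int_commute)
    show "M \<inter> {0<..} \<union> M \<inter> {..<0} \<in> sets ?W"
      unfolding sets_weighted_measure by (intro sets.Un sets.Int M) auto
  qed
  also have "\<dots> = emeasure ?W (M \<inter> {0<..}) + emeasure ?W (M \<inter> {..<0})"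
    using M by (intro plus_emeasure[symmetric]) auto
  also have "emeasure ?W (M \<inter> {..<0}) = emeasure ?W (uminus ` (M \<inter> {..<0}))"
    using M by (intro emeasure_weighted_measure_reflect[symmetric]) auto
  also have "uminus ` (M \<inter> {..<0}) = uminus ` M \<inter> {0<..}" by force
  finally show ?thesis
    using emeasure_half_mass[OF assms] emeasure_half_mass[OF admissible_sets_reflect[OF assms]]
    by simp
qed

text \<open>For \<open>r\<close> below the half radius, \<open>{0<..<r}\<close> has less mass than
  the positive part of \<open>M\<close>, so \<open>M\<close> must continue beyond \<open>r\<close>.
  All such \<open>r\<close> are therefore essential radii; this is how mass is converted into
  distance.\<close>

lemma half_radius_in_closure:
  assumes M: "M \<in> admissible_sets l" and l: "-1 < l"
  shows "half_radius l M \<in> closure (essential_radii M)"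
proof (cases "half_radius l M = 0")
  case True
  then have "half_radius l M \<in> essential_radii M" by (simp add: essential_radii_def)
  then show ?thesis using closure_subset by blast
next
  case False
  then have pos: "0 < half_radius l M" using half_radius_nonneg[of l M] by linarith
  have "r \<in> essential_radii M" if r: "r \<in> {0..<half_radius l M}" for r
  proof -
    have "r powr (l + 1) < half_radius l M powr (l + 1)"
      using r l by (intro powr_less_mono2) auto
    then have "r powr (l + 1) / (l + 1) < half_radius l M powr (l + 1) / (l + 1)"
      using l by (intro divide_strict_right_mono) auto
    then have "r powr (l + 1) / (l + 1) < half_mass l M"
      by (simp only: half_radius_mass[OF l])
    then have "ennreal (r powr (l + 1) / (l + 1)) < emeasure (weighted_measure l) (M \<inter> {0<..})"
      using l by (simp add: emeasure_half_mass[OF M] ennreal_less_iff)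
    then show ?thesis
      using not_null_beyond[of M l r] M l r by (auto simp: essential_radii_def admissible_sets_def)
  qed
  then have "{0..<half_radius l M} \<subseteq> essential_radii M" by blast
  then have "closure {0..<half_radius l M} \<subseteq> closure (essential_radii M)" by (rule closure_mono)
  then show ?thesis using pos by (auto simp: subset_eq)
qed

lemma weighted_perimeter_ge_closure_radii:
  assumes M: "M \<in> admissible_sets l" and "0 < k" "-1 < l"
    and "r \<in> closure (essential_radii M)" "s \<in> closure (essential_radii (uminus ` M))"
  shows "ereal (r powr k + s powr k) \<le> weighted_perimeter k M"
proof (rule weighted_perimeter_ge_closure)
  show "{c<..} - M \<notin> null_sets lebesgue" "{c<..} - uminus ` M \<notin> null_sets lebesgue" for c
    using M admissible_sets_reflect[OF M]
    by (simp_all add: admissible_sets_def compl_not_null[OF _ \<open>-1 < l\<close>])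
qed (use assms in \<open>simp_all add: admissible_sets_def\<close>)

section \<open>Intervals\<close>

text \<open>Test functions are bounded by 1 only on the open interval; continuity carries the bound
  to the endpoints, where the fundamental theorem of calculus evaluates them.\<close>

lemma abs_le_closure_interval:
  fixes v :: "real \<Rightarrow> real"
  assumes "continuous_on UNIV v" "\<And>x. x \<in> {a<..<b} \<Longrightarrow> \<bar>v x\<bar> \<le> c" "a < b" "x \<in> {a..b}"
  shows "\<bar>v x\<bar> \<le> c"
proof -
  have "closed {x. \<bar>v x\<bar> \<le> c}"
    using assms(1) by (intro closed_Collect_le continuous_intros)
  then have "closure {a<..<b} \<subseteq> {x. \<bar>v x\<bar> \<le> c}"
    using assms(2) by (intro closure_minimal) auto
  then show ?thesis using assms(3,4) by auto
qed

text \<open>The integral reduces to the endpoint values of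
  \<open>\<bar>x\<bar> powr k * v x\<close>, each at most the weight there in absolute
  value.\<close>

lemma weighted_perimeter_interval_le:
  assumes "a < b" "0 < k"
  shows "weighted_perimeter k {a<..<b} \<le> ereal (\<bar>a\<bar> powr k + \<bar>b\<bar> powr k)"
  unfolding weighted_perimeter_def
proof (rule SUP_least)
  fix v assume "v \<in> {v \<in> C1_compact_support. \<forall>x\<in>{a<..<b}. \<bar>v x\<bar> \<le> 1}"
  then have v: "v C1_differentiable_on UNIV" "\<And>x. x \<in> {a<..<b} \<Longrightarrow> \<bar>v x\<bar> \<le> 1"
    by (auto simp: C1_compact_support_def)
  obtain D where D: "\<And>x. (v has_real_derivative D x) (at x)"
    using v(1) by (auto simp: C1_differentiable_on_def has_real_derivative_iff_has_vector_derivative)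
  then have cont: "continuous_on UNIV v"
    by (intro continuous_at_imp_continuous_on ballI DERIV_isCont)
  note bound = abs_le_closure_interval[OF cont v(2) \<open>a < b\<close>]
  define f where "f = (\<lambda>y. \<bar>y\<bar> powr k * v y)"
  have "(deriv f has_integral (f b - f a)) {a..b}"
  \<comment> \<open>At 0 the weight may fail to be differentiable; continuity there suffices for
    this form of the theorem.\<close>
  proof (rule fundamental_theorem_of_calculus_interior_strong[of "{0}"])
    fix x assume "x \<in> {a<..<b} - {0}"
    then have "0 < x\<^sup>2" by simp
    then have "((\<lambda>y. (y\<^sup>2) powr (k/2) * v y) has_real_derivative
        (k/2) * (x\<^sup>2) powr (k/2 - 1) * (2 * x) * v x + D x * (x\<^sup>2) powr (k/2)) (at x)"
      by (auto intro!: derivative_eq_intros D)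
    then have "f field_differentiable (at x)"
      unfolding f_def abs_powr_eq_square_powr field_differentiable_def by blast
    then show "(f has_vector_derivative deriv f x) (at x)"
      by (simp add: DERIV_deriv_iff_field_differentiable flip: has_real_derivative_iff_has_vector_derivative)
  next
    show "continuous_on {a..b} f" unfolding f_def
      using \<open>0 < k\<close> by (intro continuous_intros continuous_on_powr' continuous_on_subset[OF cont]) auto
  qed (use \<open>a < b\<close> in auto)
  then have integral: "integral {a<..<b} (deriv f) = f b - f a"
    by (simp add: integral_open_interval_real[symmetric] integral_unique)
  have "(LINT x:{a<..<b}|lebesgue. deriv f x) \<le> \<bar>a\<bar> powr k + \<bar>b\<bar> powr k"
  proof (cases "set_integrable lebesgue {a<..<b} (deriv f)")
    case True
    have "\<bar>f a\<bar> \<le> \<bar>a\<bar> powr k" "\<bar>f b\<bar> \<le> \<bar>b\<bar> powr k"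
      using bound[of a] bound[of b] \<open>a < b\<close> by (auto simp: f_def abs_mult intro: mult_left_le)
    then show ?thesis
      using set_lebesgue_integral_eq_integral(2)[OF True] integral by linarith
  next
    case False
    \<comment> \<open>A function that is not integrable has integral 0 by convention, and the bound
      is nonnegative.\<close>
    then show ?thesis
      by (simp add: set_lebesgue_integral_def set_integrable_def not_integrable_integral_eq)
  qed
  then show "ereal (LINT x:{a<..<b}|lebesgue. deriv (\<lambda>y. \<bar>y\<bar> powr k * v y) x) \<le> ereal (\<bar>a\<bar> powr k + \<bar>b\<bar> powr k)"
    by (simp add: f_def)
qed

section \<open>Model intervals, and ratio bounds as perimeter bounds\<close>

lemma emeasure_unit_interval:
  assumes "-1 < l" shows "emeasure (weighted_measure l) {0<..<1} = ennreal (1 / (l + 1))"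
  using emeasure_weighted_measure_interval[OF assms, of 1] by simp

lemma emeasure_symmetric_interval:
  assumes "-1 < l" shows "emeasure (weighted_measure l) {-1<..<1} = ennreal (2 / (l + 1))"
proof -
  let ?W = "weighted_measure l"
  have U: "uminus ` {0<..<1} = {-1<..<0::real}" by auto
  have "{-1<..<1::real} = ({-1<..<0} \<union> {0<..<1}) \<union> {0}" by auto
  then have "emeasure ?W {-1<..<1} = emeasure ?W (({-1<..<0} \<union> {0<..<1}) \<union> {0})" by simp
  also have "\<dots> = emeasure ?W ({-1<..<0} \<union> {0<..<1})"
    using singleton_null_lebesgue[of 0]
    by (intro emeasure_Un_null_set) (auto simp: null_sets_weighted_measure)
  also have "\<dots> = emeasure ?W {-1<..<0} + emeasure ?W {0<..<1}"
    by (intro plus_emeasure[symmetric]) auto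
  also have "emeasure ?W {-1<..<0} = emeasure ?W {0<..<1}"
    using emeasure_weighted_measure_reflect[of "{0<..<1}" l] by (simp add: U)
  finally show ?thesis
    using assms by (simp add: emeasure_unit_interval flip: ennreal_plus add_divide_distrib)
qed

lemma unit_interval_admissible: "-1 < l \<Longrightarrow> {0<..<1} \<in> admissible_sets l"
  by (simp add: admissible_sets_def emeasure_unit_interval)

lemma symmetric_interval_admissible: "-1 < l \<Longrightarrow> {-1<..<1} \<in> admissible_sets l"
  by (simp add: admissible_sets_def emeasure_symmetric_interval)

lemma admissible_measure_pos: "M \<in> admissible_sets l \<Longrightarrow> 0 < measure (weighted_measure l) M"
  by (auto simp: admissible_sets_def measure_def enn2real_positive_iff)

lemma measure_eq_half_masses:
  "M \<in> admissible_sets l \<Longrightarrow>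
     measure (weighted_measure l) M = half_mass l M + half_mass l (uminus ` M)"
  by (simp add: measure_def emeasure_eq_half_masses del: ennreal_plus)

lemma isoperimetric_ratio_le_iff:
  assumes "M \<in> admissible_sets l"
  shows "isoperimetric_ratio k l M \<le> ereal c \<longleftrightarrow>
      weighted_perimeter k M \<le> ereal (c * measure (weighted_measure l) M powr (k / (l + 1)))"
  unfolding isoperimetric_ratio_def
  by (subst ereal_divide_le_pos) (use admissible_measure_pos[OF assms] in \<open>auto simp: mult.commute\<close>)

lemma isoperimetric_ratio_ge_iff:
  assumes "M \<in> admissible_sets l"
  shows "ereal c \<le> isoperimetric_ratio k l M \<longleftrightarrow>
      ereal (c * measure (weighted_measure l) M powr (k / (l + 1))) \<le> weighted_perimeter k M"
  unfolding isoperimetric_ratio_def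
  by (subst ereal_le_divide_pos) (use admissible_measure_pos[OF assms] in \<open>auto simp: mult.commute\<close>)

section \<open>The isoperimetric inequalities\<close>

text \<open>The half radii are limits of essential radii, and their \<open>k\<close>-th powers are
  exactly the two summands.\<close>

lemma weighted_perimeter_ge_half_masses:
  assumes M: "M \<in> admissible_sets l" and "0 < k" "-1 < l"
  shows "ereal (((l + 1) * half_mass l M) powr (k / (l + 1)) +
      ((l + 1) * half_mass l (uminus ` M)) powr (k / (l + 1))) \<le> weighted_perimeter k M"
  unfolding half_radius_powr[symmetric]
  by (intro weighted_perimeter_ge_closure_radii[OF assms] half_radius_in_closure
      M admissible_sets_reflect[OF M] \<open>-1 < l\<close>)

text \<open>Midpoint convexity with exponent \<open>p = k / (l + 1)\<close>, applied to
  \<open>l + 1\<close> times the half masses; the radial constant is \<open>2 powr (1 - p)\<close>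
  times \<open>(l + 1) powr p\<close>. The strict version detects unequal halves.\<close>

lemma isoperimetric_const_rad_le_half_masses:
  assumes M: "M \<in> admissible_sets l" and "0 < k" "-1 < l" "l + 1 \<le> k"
  shows "isoperimetric_const_rad k l * measure (weighted_measure l) M powr (k / (l + 1))
      \<le> ((l + 1) * half_mass l M) powr (k / (l + 1)) + ((l + 1) * half_mass l (uminus ` M)) powr (k / (l + 1))"
    (is "?L \<le> ?R")
    and "l + 1 < k \<Longrightarrow> half_mass l M \<noteq> half_mass l (uminus ` M) \<Longrightarrow>
      isoperimetric_const_rad k l * measure (weighted_measure l) M powr (k / (l + 1))
      < ((l + 1) * half_mass l M) powr (k / (l + 1)) + ((l + 1) * half_mass l (uminus ` M)) powr (k / (l + 1))"
proof -
  define p where "p = k / (l + 1)"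
  define x where "x = (l + 1) * half_mass l M"
  define y where "y = (l + 1) * half_mass l (uminus ` M)"
  have p: "1 \<le> p" using assms by (simp add: p_def)
  have xy: "0 \<le> x" "0 \<le> y" using assms by (auto simp: x_def y_def)
  have sum: "x + y = (l + 1) * measure (weighted_measure l) M"
    by (simp add: x_def y_def measure_eq_half_masses[OF M] distrib_left)
  then have pos: "0 < x + y" using admissible_measure_pos[OF M] assms by simp
  have "(l - k + 1) / (l + 1) = 1 - p" using assms by (simp add: p_def field_simps)
  then have L: "?L = 2 powr (1 - p) * (x + y) powr p"
    using assms by (simp add: isoperimetric_const_rad_def sum powr_mult p_def)
  show "?L \<le> ?R"
    unfolding L using powr_midpoint_convex(1)[OF xy pos p] by (simp add: p_def x_def y_def)
  show "?L < ?R" if "l + 1 < k" "half_mass l M \<noteq> half_mass l (uminus ` M)"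
  proof -
    have "1 < p" "x \<noteq> y" using that assms by (auto simp: p_def x_def y_def)
    from powr_midpoint_convex(2)[OF xy pos p this]
    show ?thesis unfolding L by (simp add: p_def x_def y_def)
  qed
qed

text \<open>The two endpoints contribute at most 1 each, and the mass is
  \<open>2 / (l + 1)\<close>.\<close>

lemma isoperimetric_ratio_symmetric_interval_le:
  assumes "0 < k" "-1 < l"
  shows "isoperimetric_ratio k l {-1<..<1} \<le> ereal (isoperimetric_const_rad k l)"
proof -
  have "(l - k + 1) / (l + 1) = 1 - k / (l + 1)" using assms by (simp add: field_simps)
  then have "isoperimetric_const_rad k l * (2 / (l + 1)) powr (k / (l + 1)) = 2"
    using assms by (simp add: isoperimetric_const_rad_def powr_divide powr_diff)
  moreover have "measure (weighted_measure l) {-1<..<1} = 2 / (l + 1)"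
    using assms by (simp add: measure_def emeasure_symmetric_interval)
  ultimately show ?thesis
    using weighted_perimeter_interval_le[of "-1" 1 k] assms
    by (simp add: isoperimetric_ratio_le_iff symmetric_interval_admissible)
qed

text \<open>The endpoint 0 costs nothing, since \<open>0 powr k = 0\<close>, so the perimeter is at
  most 1.\<close>

lemma isoperimetric_ratio_unit_interval_le:
  assumes "0 < k" "-1 < l"
  shows "isoperimetric_ratio k l {0<..<1} \<le> ereal ((l + 1) powr (k / (l + 1)))"
proof -
  have "(l + 1) powr (k / (l + 1)) * (1 / (l + 1)) powr (k / (l + 1)) = 1"
    using assms by (simp add: powr_divide)
  moreover have "measure (weighted_measure l) {0<..<1} = 1 / (l + 1)"
    using assms by (simp add: measure_def emeasure_unit_interval)
  ultimately show ?thesis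
    using weighted_perimeter_interval_le[of 0 1 k] assms
    by (simp add: isoperimetric_ratio_le_iff unit_interval_admissible)
qed

lemma isoperimetric_ratio_ge_rad:
  assumes M: "M \<in> admissible_sets l" and "0 < k" "-1 < l" "l + 1 \<le> k"
  shows "ereal (isoperimetric_const_rad k l) \<le> isoperimetric_ratio k l M"
  unfolding isoperimetric_ratio_ge_iff[OF M]
  using isoperimetric_const_rad_le_half_masses(1)[OF assms] weighted_perimeter_ge_half_masses[OF assms(1-3)]
  by (meson ereal_less_eq(3) order_trans)

text \<open>The exponent \<open>k / (l + 1)\<close> is now at most 1, and subadditivity takes the
  place of convexity: splitting the mass over both half-lines cannot pay off.\<close>

lemma isoperimetric_ratio_ge_unit_interval:
  assumes M: "M \<in> admissible_sets l" and "0 < k" "-1 < l" "k \<le> l + 1"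
  shows "ereal ((l + 1) powr (k / (l + 1))) \<le> isoperimetric_ratio k l M"
  unfolding isoperimetric_ratio_ge_iff[OF M]
proof (rule order_trans[OF _ weighted_perimeter_ge_half_masses[OF assms(1-3)]])
  have sum: "(l + 1) * half_mass l M + (l + 1) * half_mass l (uminus ` M) = (l + 1) * measure (weighted_measure l) M"
    by (simp add: measure_eq_half_masses[OF M] distrib_left)
  have "((l + 1) * measure (weighted_measure l) M) powr (k / (l + 1)) \<le>
      ((l + 1) * half_mass l M) powr (k / (l + 1)) + ((l + 1) * half_mass l (uminus ` M)) powr (k / (l + 1))"
    unfolding sum[symmetric]
    by (rule powr_subadditive) (use assms admissible_measure_pos[OF M] in \<open>auto simp: sum\<close>)
  then show "ereal ((l + 1) powr (k / (l + 1)) * measure (weighted_measure l) M powr (k / (l + 1))) \<le>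
      ereal (((l + 1) * half_mass l M) powr (k / (l + 1)) + ((l + 1) * half_mass l (uminus ` M)) powr (k / (l + 1)))"
    using assms by (simp add: powr_mult)
qed

section \<open>Rigidity of the halves\<close>

text \<open>Nullity beyond the half radius puts the positive part of \<open>M\<close> inside the
  interval up to a null set. Both have the same finite mass by the choice of the radius, so the
  interval exceeds \<open>M\<close> by a null set only.\<close>

lemma positive_part_eq_interval:
  assumes M: "M \<in> admissible_sets l" and l: "-1 < l"
    and null: "\<And>r. half_radius l M < r \<Longrightarrow> M \<inter> {r<..} \<in> null_sets lebesgue"
  shows "(M \<inter> {0<..} - {0<..<half_radius l M}) \<union> ({0<..<half_radius l M} - M) \<in> null_sets lebesgue"
proof (rule null_sets.Un)
  let ?R = "half_radius l M"
  let ?W = "weighted_measure l"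
  have Ms: "M \<in> sets lebesgue" using M by (simp add: admissible_sets_def)
  \<comment> \<open>\<open>null\<close> speaks of radii strictly larger than \<open>?R\<close>; the
    tail at \<open>?R\<close> is a countable union of such tails.\<close>
  have "M \<inter> {?R<..} = (\<Union>n. M \<inter> {?R + inverse (real (Suc n))<..})"
  proof (intro equalityI subsetI)
    fix x assume x: "x \<in> M \<inter> {?R<..}"
    then obtain n where "inverse (real (Suc n)) < x - ?R"
      using reals_Archimedean[of "x - ?R"] by auto
    then show "x \<in> (\<Union>n. M \<inter> {?R + inverse (real (Suc n))<..})"
      using x by (intro UN_I[of n]) auto
  next
    fix x assume "x \<in> (\<Union>n. M \<inter> {?R + inverse (real (Suc n))<..})"
    then obtain n where "x \<in> M" "?R + inverse (real (Suc n)) < x" by auto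
    moreover have "0 < inverse (real (Suc n))" by simp
    ultimately have "x \<in> M" "?R < x" by linarith+
    then show "x \<in> M \<inter> {?R<..}" by simp
  qed
  also have "\<dots> \<in> null_sets lebesgue"
    by (intro null_sets_UN null) simp
  finally have "{?R} \<union> M \<inter> {?R<..} \<in> null_sets lebesgue"
    by (intro null_sets.Un singleton_null_lebesgue)
  then show outer: "M \<inter> {0<..} - {0<..<?R} \<in> null_sets lebesgue"
  proof (rule null_sets_subset)
    show "M \<inter> {0<..} - {0<..<?R} \<in> sets lebesgue"
      by (intro sets.Diff sets.Int Ms) auto
  qed auto
  have "emeasure ?W (M \<inter> {0<..<?R}) = emeasure ?W (M \<inter> {0<..<?R} \<union> (M \<inter> {0<..} - {0<..<?R}))"
    using outer Ms by (intro emeasure_Un_null_set[symmetric]) (auto simp: null_sets_weighted_measure)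
  also have "M \<inter> {0<..<?R} \<union> (M \<inter> {0<..} - {0<..<?R}) = M \<inter> {0<..}" by auto
  also have "emeasure ?W (M \<inter> {0<..}) = emeasure ?W {0<..<?R}"
    using l by (simp add: emeasure_half_mass[OF M] emeasure_weighted_measure_interval half_radius_mass)
  finally have eq: "emeasure ?W (M \<inter> {0<..<?R}) = emeasure ?W {0<..<?R}" .
  have fin: "emeasure ?W {0<..<?R} \<noteq> \<infinity>"
    using l by (simp add: emeasure_weighted_measure_interval)
  have "emeasure ?W ({0<..<?R} - M \<inter> {0<..<?R}) = emeasure ?W {0<..<?R} - emeasure ?W (M \<inter> {0<..<?R})"
    using Ms fin eq by (intro emeasure_Diff) auto
  also have "\<dots> = 0" using fin by (simp add: eq)
  also have "{0<..<?R} - M \<inter> {0<..<?R} = {0<..<?R} - M" by auto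
  finally have "{0<..<?R} - M \<in> null_sets ?W" using Ms by (intro null_setsI) auto
  then show "{0<..<?R} - M \<in> null_sets lebesgue" by (simp add: null_sets_weighted_measure)
qed

text \<open>The weighted measure with exponent 0 has the null sets of \<open>lebesgue\<close> and is
  invariant under reflection.\<close>

lemma null_sets_lebesgue_reflect:
  fixes A :: "real set"
  assumes "A \<in> null_sets lebesgue" shows "uminus ` A \<in> null_sets lebesgue"
proof -
  have "A \<in> sets lebesgue" using assms by auto
  then show ?thesis
    using assms null_sets_weighted_measure[of 0] emeasure_weighted_measure_reflect[of A 0]
      sets_lebesgue_reflect[of A] by (metis null_setsD1 null_setsI sets_weighted_measure)
qed

section \<open>Conclusions for the two ranges of the exponents\<close>

lemma isoperimetric_const_eq_rad:
  assumes "0 < k" "-1 < l" "l + 1 \<le> k"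
  shows "isoperimetric_const k l = ereal (isoperimetric_const_rad k l)"
  unfolding isoperimetric_const_def
proof (rule antisym)
  show "(INF M\<in>admissible_sets l. isoperimetric_ratio k l M) \<le> ereal (isoperimetric_const_rad k l)"
    using assms by (intro INF_lower2[OF symmetric_interval_admissible]
        isoperimetric_ratio_symmetric_interval_le)
  show "ereal (isoperimetric_const_rad k l) \<le> (INF M\<in>admissible_sets l. isoperimetric_ratio k l M)"
    using assms by (intro INF_greatest isoperimetric_ratio_ge_rad)
qed

lemma isoperimetric_ratio_unit_interval_minimal:
  assumes "0 < k" "-1 < l" "k \<le> l + 1"
  shows "isoperimetric_ratio k l {0<..<1} = ereal ((l + 1) powr (k / (l + 1))) \<and>
    (\<forall>M\<in>admissible_sets l. isoperimetric_ratio k l {0<..<1} \<le> isoperimetric_ratio k l M)"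
proof -
  have "isoperimetric_ratio k l {0<..<1} = ereal ((l + 1) powr (k / (l + 1)))"
    using assms by (intro antisym isoperimetric_ratio_unit_interval_le
        isoperimetric_ratio_ge_unit_interval unit_interval_admissible)
  then show ?thesis
    using isoperimetric_ratio_ge_unit_interval[OF _ assms] by simp
qed

theorem theorem6p1:
  fixes k l :: real
  assumes "k > 0" and "l > -1"
  shows "(k \<ge> l + 1 \<longrightarrow>
           isoperimetric_const k l = ereal (isoperimetric_const_rad k l) \<and>
           (k > l + 1 \<longrightarrow>
             (\<forall>M \<in> admissible_sets l.
                isoperimetric_ratio k l M = ereal (isoperimetric_const_rad k l) \<longrightarrow>
                (\<exists>R>0. (M - {-R<..<R}) \<union> ({-R<..<R} - M) \<in> null_sets lebesgue)))) \<and>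
         (k < l + 1 \<longrightarrow>
           (\<forall>M \<in> admissible_sets l.
              isoperimetric_ratio k l M \<ge> isoperimetric_ratio k l {0<..<1}) \<and>
           isoperimetric_ratio k l {0<..<1} = ereal ((l + 1) powr (k / (l + 1))))"
proof (intro conjI impI ballI)
  assume "k \<ge> l + 1"
  then show "isoperimetric_const k l = ereal (isoperimetric_const_rad k l)"
    using assms by (intro isoperimetric_const_eq_rad)
next
  fix M assume "k > l + 1" and M: "M \<in> admissible_sets l"
    and eq: "isoperimetric_ratio k l M = ereal (isoperimetric_const_rad k l)"
  let ?N = "uminus ` M"
  let ?R = "half_radius l M"
  have N: "?N \<in> admissible_sets l" by (rule admissible_sets_reflect[OF M])
  have Ms: "M \<in> sets lebesgue" using M by (simp add: admissible_sets_def)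
  have le: "weighted_perimeter k M
      \<le> ereal (isoperimetric_const_rad k l * measure (weighted_measure l) M powr (k / (l + 1)))"
    using eq isoperimetric_ratio_le_iff[OF M] by (metis order_refl)
  note bound = order_trans[OF weighted_perimeter_ge_half_masses[OF M assms] le, unfolded ereal_less_eq]
  have "l + 1 \<le> k" using \<open>l + 1 < k\<close> by simp
  note convex = isoperimetric_const_rad_le_half_masses[OF M assms this]
  \<comment> \<open>Unequal half masses would make the convexity inequality strict, against
    \<open>bound\<close>.\<close>
  have masses: "half_mass l M = half_mass l ?N"
    using bound convex(2) \<open>l + 1 < k\<close> by fastforce
  then have radii: "half_radius l ?N = ?R" by (simp add: half_radius_def)
  \<comment> \<open>The perimeter is now at most what the radii \<open>?R\<close> on both sides
    already force.\<close>
  have total: "weighted_perimeter k M \<le> ereal (?R powr k + ?R powr k)"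
    using order_trans[OF le] convex(1) by (simp add: half_radius_powr masses)
  have "0 < half_mass l M"
    using admissible_measure_pos[OF M] measure_eq_half_masses[OF M] masses by simp
  then have "0 < ?R" using assms(2) by (simp add: half_radius_def)
  have powr_less: "?R powr k < r powr k" if "?R < r" for r
    using that assms(1) by (intro powr_less_mono2) auto
  have RM: "?R \<in> closure (essential_radii M)" "?R \<in> closure (essential_radii ?N)"
    using half_radius_in_closure[OF M assms(2)] half_radius_in_closure[OF N assms(2)] radii by auto
  note lower = order_trans[OF weighted_perimeter_ge_closure_radii[OF M assms] total, unfolded ereal_less_eq]
  \<comment> \<open>An essential radius \<open>r\<close> beyond \<open>?R\<close>, on either side,
    would raise the lower bound to \<open>r powr k + ?R powr k\<close>, above
    \<open>total\<close>.\<close>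
  have null: "M \<inter> {r<..} \<in> null_sets lebesgue" if "?R < r" for r
  proof (rule ccontr)
    assume "M \<inter> {r<..} \<notin> null_sets lebesgue"
    then have "r \<in> closure (essential_radii M)"
      using that \<open>0 < ?R\<close> closure_subset by (force simp: essential_radii_def)
    from lower[OF this RM(2)] show False using powr_less[OF that] by simp
  qed
  have null': "?N \<inter> {r<..} \<in> null_sets lebesgue" if "half_radius l ?N < r" for r
  proof (rule ccontr)
    assume "?N \<inter> {r<..} \<notin> null_sets lebesgue"
    then have "r \<in> closure (essential_radii ?N)"
      using that \<open>0 < ?R\<close> closure_subset by (force simp: essential_radii_def radii)
    from lower[OF RM(1) this] show False using powr_less[of r] that radii by simp
  qed
  \<comment> \<open>\<open>?A\<close> and \<open>?B\<close> compare the positive parts of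
    \<open>M\<close> and of its mirror image with \<open>{0<..<?R}\<close>. Once \<open>?B\<close>
    is reflected back and the origin is added, they cover the symmetric difference of
    \<open>M\<close> and \<open>{-?R<..<?R}\<close>.\<close>
  let ?A = "(M \<inter> {0<..} - {0<..<?R}) \<union> ({0<..<?R} - M)"
  let ?B = "(?N \<inter> {0<..} - {0<..<?R}) \<union> ({0<..<?R} - ?N)"
  have A: "?A \<in> null_sets lebesgue" by (rule positive_part_eq_interval[OF M assms(2) null])
  have B: "?B \<in> null_sets lebesgue"
    using positive_part_eq_interval[OF N assms(2) null'] by (simp add: radii)
  have "(?A \<union> uminus ` ?B) \<union> {0} \<in> null_sets lebesgue"
    by (rule null_sets.Un[OF null_sets.Un[OF A null_sets_lebesgue_reflect[OF B]] singleton_null_lebesgue])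
  then have "(M - {-?R<..<?R}) \<union> ({-?R<..<?R} - M) \<in> null_sets lebesgue"
  proof (rule null_sets_subset)
    show "(M - {-?R<..<?R}) \<union> ({-?R<..<?R} - M) \<subseteq> (?A \<union> uminus ` ?B) \<union> {0}"
    proof
      fix x assume x: "x \<in> (M - {-?R<..<?R}) \<union> ({-?R<..<?R} - M)"
      have mem: "- x \<in> ?N \<longleftrightarrow> x \<in> M" by force
      consider "0 < x" | "x = 0" | "x < 0" by linarith
      then show "x \<in> (?A \<union> uminus ` ?B) \<union> {0}"
      proof cases
        case 3
        then have "- x \<in> ?B" using x \<open>0 < ?R\<close> by (auto simp: mem)
        then have "x \<in> uminus ` ?B" by (metis image_eqI minus_minus)
        then show ?thesis by blast
      qed (use x \<open>0 < ?R\<close> in auto)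
    qed
    show "(M - {-?R<..<?R}) \<union> ({-?R<..<?R} - M) \<in> sets lebesgue"
      by (intro sets.Un sets.Diff Ms) auto
  qed
  then show "\<exists>R>0. (M - {-R<..<R}) \<union> ({-R<..<R} - M) \<in> null_sets lebesgue"
    using \<open>0 < ?R\<close> by blast
qed (use assms isoperimetric_ratio_unit_interval_minimal[of k l] in auto)

end
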